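(* Let $|q_{ij}|=1$ for $1\le i,j\le n$, let $m\ge 1$, and let $P_m$ be the operator on $(\mathbb{C}^n)^{\otimes m}$ defined by $$P_m=\frac{1}{m!}\sum_{\sigma\in\mathcal{S}_m}U^{m,q}_\sigma .$$ Then $P_m$ is the (orthogonal) projection of $(\mathbb{C}^n)^{\otimes m}$ onto $(\mathbb{C}^n)^{(q,m)}=\{u\in(\mathbb{C}^n)^{\otimes m}:U^{m,q}_\sigma u=u\ \forall\sigma\in\mathcal{S}_m\}$.
   Context: Fix complex numbers $(q_{ij})_{1\le i,j\le n}$ with $|q_{ij}|=1$, $q_{ii}=1$ and $q_{ji}=q_{ij}^{-1}=\overline{q_{ij}}$. Let $\{e_1,\ldots,e_n\}$ be the standard orthonormal basis of $\mathbb{C}^n$ and $\mathcal{S}_m$ the group of permutations of $\{1,\ldots,m\}$. For $\sigma\in\mathcal{S}_m$ and $x=(x_1,\ldots,x_m)\in\{1,\ldots,n\}^m$ put $q^\sigma(x)=\prod q_{x_{\sigma^{-1}(i)}x_{\sigma^{-1}(k)}}$, the product over pairs $(i,k)$ with $1\le i<k\le m$ and $\sigma^{-1}(i)>\sigma^{-1}(k)$. (It is the scalar for which $T_{x_1}\cdots T_{x_m}=q^\sigma(x)T_{x_{\sigma^{-1}(1)}}\cdots T_{x_{\sigma^{-1}(m)}}$ is obtained by successively applying the relations $T_jT_i=q_{ij}T_iT_j$ to adjacent factors.) $U^{m,q}_\sigma$ is the linear operator on $(\mathbb{C}^n)^{\otimes m}$ with $U^{m,q}_\sigma(e_{x_1}\otimes\cdots\otimes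 e_{x_m})=q^\sigma(x)\,e_{x_{\sigma^{-1}(1)}}\otimes\cdots\otimes e_{x_{\sigma^{-1}(m)}}$ for all $x$. *)

theory Defs
  imports "HOL-Analysis.Analysis" "HOL-Combinatorics.Permutations"
begin

text \<open>
  The standard Hermitian inner product on coordinate space; it is linear in the first argument.
\<close>

definition cinner :: "complex ^ 'i \<Rightarrow> complex ^ 'i \<Rightarrow> complex" where
  "cinner u v = (\<Sum>i\<in>UNIV. u $ i * cnj (v $ i))"

definition orthogonal_projection_onto ::
    "(complex ^ 'i \<Rightarrow> complex ^ 'i) \<Rightarrow> (complex ^ 'i) set \<Rightarrow> bool" where
  "orthogonal_projection_onto P S \<longleftrightarrow>
     Vector_Spaces.linear (*s) (*s) P \<and> (\<forall>u. P (P u) = P u) \<and>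
     (\<forall>u v. cinner (P u) v = cinner u (P v)) \<and> range P = S"

text \<open>
  The index set \<open>{1, \<dots>, n}\<close> is a finite type \<^typ>\<open>'n\<close> and the set \<open>{1, \<dots>, m}\<close> of tensor
  positions is a finite linearly ordered type \<^typ>\<open>'m\<close>, so multi-indices are the elements of
  \<open>'n ^ 'm\<close>.  The \<open>m\<close>-th tensor power of \<open>\<complex>\<^sup>n\<close> is taken in coordinates with
  respect to the basis of products of standard basis vectors.  The lemmas
  \<open>cinner_elementary_tensor\<close>, \<open>cinner_basis_tensor\<close> and \<open>sum_basis_tensor\<close> below say that
  \<^const>\<open>cinner\<close> is the tensor product inner product and that the product vectors form an
  orthonormal basis.
\<close>

type_synonym ('n, 'm) tensor_power = "complex ^ ('n ^ 'm)"

definition elementary_tensor ::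
    "('m::finite \<Rightarrow> complex ^ 'n::finite) \<Rightarrow> ('n, 'm) tensor_power" where
  "elementary_tensor v = (\<chi> x. \<Prod>i\<in>UNIV. v i $ (x $ i))"

definition basis_tensor :: "'n::finite ^ 'm::finite \<Rightarrow> ('n, 'm) tensor_power" where
  "basis_tensor x = elementary_tensor (\<lambda>i. axis (x $ i) 1)"

lemma cinner_elementary_tensor:
  fixes v w :: "'m::finite \<Rightarrow> complex ^ 'n::finite"
  shows "cinner (elementary_tensor v) (elementary_tensor w) = (\<Prod>i\<in>UNIV. cinner (v i) (w i))"
proof -
  have bij: "bij_betw (\<lambda>x::'n ^ 'm. ($) x) UNIV (UNIV :: ('m \<Rightarrow> 'n) set)"
    by (rule bij_betwI[where g = vec_lambda]) auto
  have "(\<Prod>i\<in>UNIV. cinner (v i) (w i))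
      = (\<Sum>f\<in>UNIV. \<Prod>i\<in>UNIV. v i $ f i * cnj (w i $ f i))"
    unfolding cinner_def using prod_sum_PiE[of "UNIV :: 'm set" "\<lambda>_. UNIV :: 'n set"
        "\<lambda>i j. v i $ j * cnj (w i $ j)"] by (simp add: PiE_UNIV_domain)
  also have "\<dots> = (\<Sum>x\<in>UNIV. \<Prod>i\<in>UNIV. v i $ (x $ i) * cnj (w i $ (x $ i)))"
    using sum.reindex_bij_betw[OF bij,
        of "\<lambda>f. \<Prod>i\<in>UNIV. v i $ f i * cnj (w i $ f i)"] by simp
  finally show ?thesis
    by (simp add: cinner_def elementary_tensor_def prod.distrib)
qed

lemma basis_tensor_eq_axis: "basis_tensor x = axis x 1"
proof (rule vec_eq_iff[THEN iffD2], intro allI)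
  fix y
  show "basis_tensor x $ y = axis x 1 $ y"
  proof (cases "y = x")
    case True
    then show ?thesis by (simp add: basis_tensor_def elementary_tensor_def axis_def)
  next
    case False
    then obtain i where "y $ i \<noteq> x $ i" by (auto simp: vec_eq_iff)
    then show ?thesis using False
      by (auto simp: basis_tensor_def elementary_tensor_def axis_def intro!: prod_zero)
  qed
qed

lemma cinner_basis_tensor: "cinner (basis_tensor x) (basis_tensor y) = (if x = y then 1 else 0)"
  by (auto simp: cinner_def basis_tensor_eq_axis axis_def if_distrib[of cnj]
      if_distrib[of "\<lambda>c. _ * c"] cong: if_cong)

lemma sum_basis_tensor: "u = (\<Sum>x\<in>UNIV. (u $ x) *s basis_tensor x)"
  by (simp add: basis_tensor_eq_axis basis_expansion)

definition q_factor ::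
    "('n \<Rightarrow> 'n \<Rightarrow> complex) \<Rightarrow> ('m::{finite,linorder} \<Rightarrow> 'm) \<Rightarrow> 'n ^ 'm::{finite,linorder} \<Rightarrow> complex" where
  "q_factor q \<sigma> x =
     (\<Prod>(i, k)\<in>{(i, k). i < k \<and> inv \<sigma> i > inv \<sigma> k}. q (x $ inv \<sigma> i) (x $ inv \<sigma> k))"

definition permute_index :: "('m::finite \<Rightarrow> 'm) \<Rightarrow> 'n ^ 'm \<Rightarrow> 'n ^ 'm" where
  "permute_index \<sigma> x = (\<chi> i. x $ inv \<sigma> i)"

text \<open>
  The operator \<open>U\<close> is the linear extension of its values on the basis tensors, as confirmed by
  \<open>linear_q_perm_op\<close> and \<open>q_perm_op_basis_tensor\<close>.
\<close>

definition q_perm_op ::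
    "('n::finite \<Rightarrow> 'n \<Rightarrow> complex) \<Rightarrow> ('m::{finite,linorder} \<Rightarrow> 'm) \<Rightarrow>
     ('n, 'm) tensor_power \<Rightarrow> ('n, 'm) tensor_power" where
  "q_perm_op q \<sigma> u =
     (\<Sum>x\<in>UNIV. (u $ x) *s (q_factor q \<sigma> x *s basis_tensor (permute_index \<sigma> x)))"

lemma linear_q_perm_op: "Vector_Spaces.linear (*s) (*s) (q_perm_op q \<sigma>)"
  by (auto intro!: Vector_Spaces.linear_iff[THEN iffD2] vec.vector_space_axioms
      simp: q_perm_op_def sum.distrib vec.scale_sum_right vector_sadd_rdistrib
        vector_add_ldistrib vector_smult_assoc algebra_simps)

lemma q_perm_op_basis_tensor:
  "q_perm_op q \<sigma> (basis_tensor x) = q_factor q \<sigma> x *s basis_tensor (permute_index \<sigma> x)"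
  unfolding q_perm_op_def basis_tensor_eq_axis[of x]
  by (subst sum.remove[of _ x]) (auto simp: axis_def intro!: sum.neutral)

definition q_symmetrizer ::
    "('n::finite \<Rightarrow> 'n \<Rightarrow> complex) \<Rightarrow>
     ('n, 'm::{finite,linorder}) tensor_power \<Rightarrow> ('n, 'm) tensor_power" where
  "q_symmetrizer q u =
     (1 / fact CARD('m)) *s (\<Sum>\<sigma> | \<sigma> permutes UNIV. q_perm_op q \<sigma> u)"

definition q_symmetric_tensors ::
    "('n::finite \<Rightarrow> 'n \<Rightarrow> complex) \<Rightarrow> ('n, 'm::{finite,linorder}) tensor_power set" where
  "q_symmetric_tensors q = {u. \<forall>\<sigma>. \<sigma> permutes UNIV \<longrightarrow> q_perm_op q \<sigma> u = u}"

end

theory Submission imports Defs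
begin

text \<open>
  The operators \<open>U\<^sub>\<sigma>\<close> form a unitary representation of the symmetric group, and the average of
  a unitary representation of a finite group is the orthogonal projection onto its fixed vectors.

  The representation property rests on a cocycle identity for the scalars \<open>q\<^sup>\<sigma>(x)\<close>
  (lemma \<open>q_factor_comp\<close>).  Each \<open>q\<^sup>\<sigma>(x)\<close> is a product over the unordered pairs of tensor
  positions, a pair contributing the exchange scalar of its two factors if \<open>\<sigma>\<close> reverses their
  order and 1 otherwise.  Follow one pair through \<open>\<tau>\<close> and then \<open>\<sigma>\<close>.  If at most one of the two steps
  exchanges the pair, the contributions visibly multiply; if both do, the composite restores the
  original order and contributes 1, while the two exchanges contribute \<open>q\<^sub>i\<^sub>j\<close> and
  \<open>q\<^sub>j\<^sub>i = q\<^sub>i\<^sub>j\<^sup>-\<^sup>1\<close>, whose product is also 1.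

  Unitarity (lemma \<open>cinner_q_perm_op\<close>) holds because \<open>U\<^sub>\<sigma>\<close> permutes an orthonormal basis up to
  scalars of modulus one; hence the adjoint of \<open>U\<^sub>\<sigma>\<close> is \<open>U\<close> at the inverse of \<open>\<sigma>\<close>.
  For the average, translating the summation variable by a group element gives
  \<open>U\<^sub>\<sigma> P = P\<close>, so the range consists of fixed vectors, on which \<open>P\<close> is the identity;
  inverting the summation variable gives self-adjointness.
\<close>

section \<open>The cocycle identity\<close>

text \<open>
  The product over inversions indexed by original positions instead of by final ones; since
  non-inverted pairs are given the factor 1, the index set no longer depends on \<open>\<sigma>\<close>, which allows
  factors of different permutations to be compared pair by pair.
\<close>

lemma q_factor_eq_prod_pairs:
  fixes \<sigma> :: "'m::{finite,linorder} \<Rightarrow> 'm" and x :: "'n ^ 'm::{finite,linorder}"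
  assumes "bij \<sigma>"
  shows "q_factor q \<sigma> x =
    (\<Prod>(a, b)\<in>{(a, b). a < b}. if \<sigma> b < \<sigma> a then q (x $ b) (x $ a) else 1)"
proof -
  have cancel: "inv \<sigma> (\<sigma> a) = a" "\<sigma> (inv \<sigma> a) = a" for a
    using assms by (simp_all add: bij_is_inj bij_is_surj surj_f_inv_f)
  have "q_factor q \<sigma> x = (\<Prod>(a, b)\<in>{(a, b). a < b \<and> \<sigma> b < \<sigma> a}. q (x $ b) (x $ a))"
    unfolding q_factor_def
    by (rule prod.reindex_bij_witness[where i = "\<lambda>(a, b). (\<sigma> b, \<sigma> a)"
          and j = "\<lambda>(i, k). (inv \<sigma> k, inv \<sigma> i)"]) (auto simp: cancel)
  also have "\<dots> = (\<Prod>(a, b)\<in>{(a, b). a < b}. if \<sigma> b < \<sigma> a then q (x $ b) (x $ a) else 1)"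
    by (rule prod.mono_neutral_cong_left) (auto split: if_splits)
  finally show ?thesis .
qed

lemma permute_index_nth [simp]: "bij \<sigma> \<Longrightarrow> permute_index \<sigma> x $ \<sigma> a = x $ a"
  by (simp add: permute_index_def bij_is_inj)

lemma permute_index_comp:
  assumes "bij \<sigma>" "bij \<tau>"
  shows "permute_index (\<sigma> \<circ> \<tau>) x = permute_index \<sigma> (permute_index \<tau> x)"
  by (simp add: permute_index_def o_inv_distrib assms)

lemma bij_permute_index:
  assumes "bij \<sigma>"
  shows "bij (permute_index \<sigma>)"
proof (rule o_bij)
  show "permute_index (inv \<sigma>) \<circ> permute_index \<sigma> = id" "permute_index \<sigma> \<circ> permute_index (inv \<sigma>) = id"
    using assms by (auto simp: fun_eq_iff vec_eq_iff permute_index_def inv_inv_eq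
        bij_is_inj bij_is_surj surj_f_inv_f)
qed

lemma bij_betw_sorted_image_pair:
  fixes \<tau> :: "'m::linorder \<Rightarrow> 'm"
  assumes "bij \<tau>"
  shows "bij_betw (\<lambda>(a, b). (min (\<tau> a) (\<tau> b), max (\<tau> a) (\<tau> b))) {(a, b). a < b} {(a, b). a < b}"
proof -
  have inv: "inv \<tau> (\<tau> a) = a" "\<tau> (inv \<tau> a) = a" for a
    using assms by (simp_all add: bij_is_inj bij_is_surj surj_f_inv_f)
  have sorted: "min (f a) (f b) < max (f a) (f b)" if "bij f" "a < b" for f :: "'m \<Rightarrow> 'm" and a b
  proof -
    have "f a \<noteq> f b"
      using that by (auto simp: bij_def inj_eq)
    then show ?thesis
      by (auto simp: min_def max_def)
  qed
  show ?thesis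
    by (rule bij_betwI[where g = "\<lambda>(a, b). (min (inv \<tau> a) (inv \<tau> b), max (inv \<tau> a) (inv \<tau> b))"])
      (use sorted[OF assms] sorted[OF bij_imp_bij_inv[OF assms]] in
        \<open>auto simp: inv min_def max_def split: if_splits\<close>)
qed

text \<open>
  Sorting the pair \<open>(\<tau> a, \<tau> b)\<close> matches the pairs of positions before and after applying \<open>\<tau>\<close>;
  the identity then holds for each pair separately, the inverse relation being needed exactly
  when both permutations exchange the pair.
\<close>

lemma q_factor_comp:
  fixes q :: "'n \<Rightarrow> 'n \<Rightarrow> complex" and \<sigma> \<tau> :: "'m::{finite,linorder} \<Rightarrow> 'm" and x :: "'n ^ 'm::{finite,linorder}"
  assumes nz: "\<And>i j. q i j \<noteq> 0" and inv: "\<And>i j. q j i = inverse (q i j)"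
    and \<sigma>: "bij \<sigma>" and \<tau>: "bij \<tau>"
  shows "q_factor q (\<sigma> \<circ> \<tau>) x = q_factor q \<tau> x * q_factor q \<sigma> (permute_index \<tau> x)"
proof -
  let ?y = "permute_index \<tau> x"
  define g where "g = (\<lambda>(c, d). if \<sigma> d < \<sigma> c then q (?y $ d) (?y $ c) else 1)"
  define s where "s = (\<lambda>(a, b). (min (\<tau> a) (\<tau> b), max (\<tau> a) (\<tau> b)))"
  have canc: "q j i * q i j = 1" for i j
    using nz[of i j] by (simp add: inv[of j i])
  have "q_factor q \<sigma> ?y = (\<Prod>p\<in>{(c, d). c < d}. g p)"
    by (simp add: q_factor_eq_prod_pairs \<sigma> g_def)
  also have "\<dots> = (\<Prod>p\<in>{(a, b). a < b}. g (s p))"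
    unfolding s_def by (rule prod.reindex_bij_betw[symmetric]) (rule bij_betw_sorted_image_pair[OF \<tau>])
  finally have "q_factor q \<tau> x * q_factor q \<sigma> ?y =
      (\<Prod>p\<in>{(a, b). a < b}. (case p of (a, b) \<Rightarrow> if \<tau> b < \<tau> a then q (x $ b) (x $ a) else 1) * g (s p))"
    by (simp add: q_factor_eq_prod_pairs \<tau> prod.distrib)
  also have "\<dots> = (\<Prod>(a, b)\<in>{(a, b). a < b}. if \<sigma> (\<tau> b) < \<sigma> (\<tau> a) then q (x $ b) (x $ a) else 1)"
  proof (rule prod.cong[OF refl], clarify)
    fix a b :: 'm
    assume "a < b"
    then have "\<tau> a \<noteq> \<tau> b" "\<sigma> (\<tau> a) \<noteq> \<sigma> (\<tau> b)"
      using \<sigma> \<tau> by (auto simp: bij_def inj_eq)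
    then show "(if \<tau> b < \<tau> a then q (x $ b) (x $ a) else 1) * g (s (a, b)) =
        (if \<sigma> (\<tau> b) < \<sigma> (\<tau> a) then q (x $ b) (x $ a) else 1)"
      using \<tau> canc by (cases "\<tau> b < \<tau> a") (auto simp: g_def s_def min_def max_def)
  qed
  also have "\<dots> = q_factor q (\<sigma> \<circ> \<tau>) x"
    by (simp add: q_factor_eq_prod_pairs bij_comp \<sigma> \<tau>)
  finally show ?thesis ..
qed

lemma cmod_q_factor:
  assumes "\<And>i j. cmod (q i j) = 1"
  shows "cmod (q_factor q \<sigma> x) = 1"
  by (auto simp: q_factor_def prod_norm[symmetric] assms intro!: prod.neutral)

section \<open>A unitary representation of the symmetric group\<close>

text \<open>
  In coordinates \<open>U\<^sub>\<sigma>\<close> is a weighted relabelling, and evaluating at a relabelled index avoids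
  any inverse permutation; composition and unitarity both follow from this formula.
\<close>

lemma q_perm_op_nth_permute_index:
  assumes "bij \<sigma>"
  shows "q_perm_op q \<sigma> u $ permute_index \<sigma> x = q_factor q \<sigma> x * u $ x"
proof -
  note inj = bij_is_inj[OF bij_permute_index[OF assms]]
  have "q_perm_op q \<sigma> u $ permute_index \<sigma> x =
      (\<Sum>y\<in>UNIV. if y = x then u $ y * q_factor q \<sigma> y else 0)"
    by (auto simp: q_perm_op_def basis_tensor_eq_axis axis_def inj_eq[OF inj]
        if_distrib[of "\<lambda>c. _ * c"] cong: if_cong)
  then show ?thesis by simp
qed

lemma tensor_eqI_permute_index:
  fixes u v :: "complex ^ ('n::finite ^ 'm::finite)"
  assumes "bij \<sigma>" "\<And>x. u $ permute_index \<sigma> x = v $ permute_index \<sigma> x"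
  shows "u = v"
  using assms bij_is_surj[OF bij_permute_index[OF assms(1)]] by (metis vec_eq_iff surjD)

lemma q_perm_op_id: "q_perm_op q id u = u"
  by (rule tensor_eqI_permute_index[OF bij_id])
    (simp only: q_perm_op_nth_permute_index[OF bij_id],
      simp add: q_factor_eq_prod_pairs permute_index_def, auto intro!: prod.neutral)

lemma q_perm_op_comp:
  fixes q :: "'n::finite \<Rightarrow> 'n \<Rightarrow> complex" and \<sigma> \<tau> :: "'m::{finite,linorder} \<Rightarrow> 'm"
  assumes "\<And>i j. q i j \<noteq> 0" "\<And>i j. q j i = inverse (q i j)" and \<sigma>: "bij \<sigma>" and \<tau>: "bij \<tau>"
  shows "q_perm_op q (\<sigma> \<circ> \<tau>) u = q_perm_op q \<sigma> (q_perm_op q \<tau> u)"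
proof (rule tensor_eqI_permute_index[OF bij_comp[OF \<tau> \<sigma>]])
  fix x
  have "q_perm_op q (\<sigma> \<circ> \<tau>) u $ permute_index (\<sigma> \<circ> \<tau>) x =
      q_factor q \<sigma> (permute_index \<tau> x) * (q_factor q \<tau> x * u $ x)"
    by (simp add: q_perm_op_nth_permute_index[OF bij_comp[OF \<tau> \<sigma>]] q_factor_comp[OF assms])
  also have "\<dots> = q_perm_op q \<sigma> (q_perm_op q \<tau> u) $ permute_index (\<sigma> \<circ> \<tau>) x"
    by (simp add: permute_index_comp[OF \<sigma> \<tau>] q_perm_op_nth_permute_index \<sigma> \<tau>)
  finally show "q_perm_op q (\<sigma> \<circ> \<tau>) u $ permute_index (\<sigma> \<circ> \<tau>) x = \<dots>" .
qed

lemma cinner_q_perm_op: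
  fixes \<sigma> :: "'m::{finite,linorder} \<Rightarrow> 'm"
  assumes q: "\<And>i j. cmod (q i j) = 1" and \<sigma>: "bij \<sigma>"
  shows "cinner (q_perm_op q \<sigma> u) (q_perm_op q \<sigma> v) = cinner u v"
proof -
  have unimodular: "q_factor q \<sigma> x * cnj (q_factor q \<sigma> x) = 1" for x
    using cmod_q_factor[of q \<sigma> x, OF q] by (simp add: complex_norm_square[symmetric])
  have "cinner (q_perm_op q \<sigma> u) (q_perm_op q \<sigma> v) =
      (\<Sum>x\<in>UNIV. q_perm_op q \<sigma> u $ permute_index \<sigma> x * cnj (q_perm_op q \<sigma> v $ permute_index \<sigma> x))"
    unfolding cinner_def by (rule sum.reindex_bij_betw[OF bij_permute_index[OF \<sigma>], symmetric])
  also have "\<dots> = (\<Sum>x\<in>UNIV. (q_factor q \<sigma> x * cnj (q_factor q \<sigma> x)) * (u $ x * cnj (v $ x)))"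
    by (simp add: q_perm_op_nth_permute_index[OF \<sigma>] mult_ac)
  also have "\<dots> = cinner u v"
    by (simp add: unimodular cinner_def)
  finally show ?thesis .
qed

text \<open>Insert \<open>U\<^sub>\<sigma>\<close> composed with its inverse in the second argument and cancel \<open>U\<^sub>\<sigma>\<close> by unitarity.\<close>

lemma cinner_q_perm_op_adjoint:
  fixes q :: "'n::finite \<Rightarrow> 'n \<Rightarrow> complex" and \<sigma> :: "'m::{finite,linorder} \<Rightarrow> 'm"
  assumes q: "\<And>i j. cmod (q i j) = 1" "\<And>i j. q j i = inverse (q i j)" and \<sigma>: "bij \<sigma>"
  shows "cinner (q_perm_op q \<sigma> u) v = cinner u (q_perm_op q (inv \<sigma>) v)"
proof -
  have nz: "q i j \<noteq> 0" for i j
    using q(1)[of i j] by auto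
  have "v = q_perm_op q (\<sigma> \<circ> inv \<sigma>) v"
    using bij_is_surj[OF \<sigma>] by (metis q_perm_op_id surj_iff)
  also have "\<dots> = q_perm_op q \<sigma> (q_perm_op q (inv \<sigma>) v)"
    by (rule q_perm_op_comp[OF nz q(2) \<sigma> bij_imp_bij_inv[OF \<sigma>]])
  finally have v: "v = q_perm_op q \<sigma> (q_perm_op q (inv \<sigma>) v)" .
  have "cinner (q_perm_op q \<sigma> u) v =
      cinner (q_perm_op q \<sigma> u) (q_perm_op q \<sigma> (q_perm_op q (inv \<sigma>) v))"
    by (rule arg_cong[OF v])
  also have "\<dots> = cinner u (q_perm_op q (inv \<sigma>) v)"
    by (rule cinner_q_perm_op[of q, OF q(1) \<sigma>])
  finally show ?thesis .
qed

section \<open>Averaging over the group\<close>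

lemma cinner_scale_sum_left: "cinner (c *s (\<Sum>i\<in>I. f i)) v = c * (\<Sum>i\<in>I. cinner (f i) v)"
  unfolding cinner_def
  by (simp add: sum_distrib_left sum_distrib_right mult.assoc) (rule sum.swap)

lemma cinner_scale_sum_right: "cinner u (c *s (\<Sum>i\<in>I. f i)) = cnj c * (\<Sum>i\<in>I. cinner u (f i))"
  unfolding cinner_def
  by (simp add: sum_distrib_left mult_ac) (rule sum.swap)

lemma linear_q_symmetrizer:
  fixes q :: "'a::finite \<Rightarrow> 'a \<Rightarrow> complex"
  shows "Vector_Spaces.linear (*s) (*s)
    (q_symmetrizer q :: ('a, 'b::{finite,linorder}) tensor_power \<Rightarrow> _)"
proof -
  have "q_perm_op q \<sigma> (u + v) = q_perm_op q \<sigma> u + q_perm_op q \<sigma> v"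
    "q_perm_op q \<sigma> (c *s u) = c *s q_perm_op q \<sigma> u"
    for \<sigma> :: "'b \<Rightarrow> 'b" and u v :: "('a, 'b) tensor_power" and c
    using linear_q_perm_op[of q \<sigma>] by (simp_all add: Vector_Spaces.linear_iff)
  then show ?thesis
    by (auto intro!: Vector_Spaces.linear_iff[THEN iffD2] vec.vector_space_axioms
        simp: q_symmetrizer_def sum.distrib vector_add_ldistrib vec_eq_iff sum_distrib_left
          sum_divide_distrib add_divide_distrib mult_ac)
qed

text \<open>Left translation by \<open>\<sigma>\<close> only permutes the summands of the average.\<close>

lemma q_perm_op_q_symmetrizer:
  fixes q :: "'n::finite \<Rightarrow> 'n \<Rightarrow> complex" and \<sigma> :: "'m::{finite,linorder} \<Rightarrow> 'm"
  assumes q: "\<And>i j. q i j \<noteq> 0" "\<And>i j. q j i = inverse (q i j)" and \<sigma>: "\<sigma> permutes UNIV"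
  shows "q_perm_op q \<sigma> (q_symmetrizer q u) = q_symmetrizer q u"
proof -
  interpret U: Vector_Spaces.linear "(*s)" "(*s)" "q_perm_op q \<sigma>"
    by (rule linear_q_perm_op)
  have "q_perm_op q \<sigma> (q_symmetrizer q u) =
      (1 / fact CARD('m)) *s (\<Sum>\<tau> | \<tau> permutes UNIV. q_perm_op q (\<sigma> \<circ> \<tau>) u)"
    unfolding q_symmetrizer_def U.scale U.sum
    by (simp add: q_perm_op_comp[of q, OF q] permutes_bij[of _ "UNIV :: 'm set"] \<sigma>)
  also have "(\<Sum>\<tau> | \<tau> permutes UNIV. q_perm_op q (\<sigma> \<circ> \<tau>) u) =
      (\<Sum>\<tau> | \<tau> permutes UNIV. q_perm_op q \<tau> u)"
    by (rule setum_permutations_compose_left[OF \<sigma>, symmetric])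
  finally show ?thesis
    by (simp add: q_symmetrizer_def)
qed

lemma q_symmetrizer_fixes:
  fixes u :: "('n::finite, 'm::{finite,linorder}) tensor_power"
  assumes "u \<in> q_symmetric_tensors q"
  shows "q_symmetrizer q u = u"
proof -
  have "(\<Sum>\<sigma> | \<sigma> permutes (UNIV :: 'm set). q_perm_op q \<sigma> u) = (\<Sum>\<sigma> | \<sigma> permutes (UNIV :: 'm set). u)"
    using assms by (intro sum.cong) (auto simp: q_symmetric_tensors_def)
  also have "\<dots> = (fact CARD('m) :: complex) *s u"
    by (simp only: vec_eq_iff sum_component vector_smult_component) (simp add: card_permutations)
  finally show ?thesis
    by (simp add: q_symmetrizer_def vector_smult_assoc)
qed

text \<open>
  Inversion permutes the group, so the sum of the adjoints \<open>U\<close> at \<open>\<sigma>\<^sup>-\<^sup>1\<close> is the sum of the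
  operators themselves.
\<close>

lemma cinner_q_symmetrizer:
  fixes q :: "'n::finite \<Rightarrow> 'n \<Rightarrow> complex" and u v :: "('n, 'm::{finite,linorder}) tensor_power"
  assumes q: "\<And>i j. cmod (q i j) = 1" "\<And>i j. q j i = inverse (q i j)"
  shows "cinner (q_symmetrizer q u) v = cinner u (q_symmetrizer q v)"
proof -
  have "(\<Sum>\<sigma> | \<sigma> permutes UNIV. cinner (q_perm_op q \<sigma> u) v) =
      (\<Sum>\<sigma> | \<sigma> permutes UNIV. cinner u (q_perm_op q (inv \<sigma>) v))"
    by (intro sum.cong refl cinner_q_perm_op_adjoint q) (auto intro: permutes_bij)
  also have "\<dots> = (\<Sum>\<sigma> | \<sigma> permutes UNIV. cinner u (q_perm_op q \<sigma> v))"
    by (rule sum_permutations_inverse[symmetric])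
  finally show ?thesis
    by (simp add: q_symmetrizer_def cinner_scale_sum_left cinner_scale_sum_right)
qed

theorem lemma10:
  fixes q :: "'n::finite \<Rightarrow> 'n \<Rightarrow> complex"
  assumes "\<And>i j. cmod (q i j) = 1"
    and "\<And>i. q i i = 1"
    and "\<And>i j. q j i = inverse (q i j)"
  shows "orthogonal_projection_onto
    (q_symmetrizer q :: ('n, 'm::{finite,linorder}) tensor_power \<Rightarrow> ('n, 'm) tensor_power)
    (q_symmetric_tensors q)"
proof -
  let ?P = "q_symmetrizer q :: ('n, 'm) tensor_power \<Rightarrow> ('n, 'm) tensor_power"
  have nz: "q i j \<noteq> 0" for i j
    using assms(1)[of i j] by auto
  have symmetric: "?P u \<in> q_symmetric_tensors q" for u
    by (simp add: q_symmetric_tensors_def q_perm_op_q_symmetrizer[of q, OF nz assms(3)])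
  have idempotent: "?P (?P u) = ?P u" for u
    by (rule q_symmetrizer_fixes[OF symmetric])
  have range: "range ?P = q_symmetric_tensors q"
    using symmetric q_symmetrizer_fixes by (metis image_subset_iff rangeI subsetI subset_antisym)
  show ?thesis
    unfolding orthogonal_projection_onto_def
    using linear_q_symmetrizer idempotent cinner_q_symmetrizer[of q, OF assms(1,3)] range by blast
qed

end
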